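(* Let $V$, $H$, $\widetilde{H}$ be complex Hilbert spaces, let $j \colon V \to H$ be a continuous linear map and $\tilde{j} \colon V \to \widetilde{H}$ a compact linear map. Let $\mathfrak{a}$ and, for all $n \in \mathbb{N}$, $\mathfrak{a}_n$ be continuous symmetric sesquilinear forms $V \times V \to \mathbb{C}$. Suppose that the sequence $(\mathfrak{a}_n)_{n \in \mathbb{N}}$ is uniformly $\tilde{j}$-elliptic and converges weakly to $\mathfrak{a}$. Moreover, suppose that $W(\mathfrak{a}) = \{0\}$. Let $A_n$ be the graph associated with $(\mathfrak{a}_n,j)$ and $A$ the graph associated with $(\mathfrak{a},j)$. Then $$\lim_{n \to \infty} (A_n + i s I)^{-1} = (A + i s I)^{-1}$$ strongly for all $s \in \mathbb{R} \setminus \{0\}$. Moreover, if in addition the map $j$ is compact, then the convergence is uniform in $\mathcal{L}(H)$ (i.e. in operator norm).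
   Context: Sesquilinear forms are linear in the first and antilinear in the second variable, and $\mathfrak{a}(u) := \mathfrak{a}(u,u)$. $\mathcal{L}(H)$ denotes the bounded linear operators on $H$. The sequence $(\mathfrak{a}_n)$ is uniformly $\tilde{j}$-elliptic if there exist $\mu,\omega > 0$ such that $\mathfrak{a}_n(u) + \omega \|\tilde{j}(u)\|_{\widetilde{H}}^2 \geq \mu \|u\|_V^2$ for all $n \in \mathbb{N}$ and $u \in V$. The sequence $(\mathfrak{a}_n)$ converges weakly to $\mathfrak{a}$ if $\lim_{n\to\infty} \mathfrak{a}_n(u_n,v) = \mathfrak{a}(u,v)$ for all $v \in V$ and all $u,u_1,u_2,\ldots \in V$ with $u_n \to u$ weakly in $V$. $W(\mathfrak{a}) := \{u \in \ker j : \mathfrak{a}(u,v) = 0 \text{ for all } v \in V\}$. A graph in $H$ is a linear subspace of $H \times H$. The graph associated with a form $\mathfrak{b}$ on $V$ and $j$ is $$\{(x,y) \in H \times H : \text{there exists } u \in V \text{ such that } j(u) = x \text{ and } \mathfrak{b}(u,v) = (y,j(v))_H \text{ for all } v \in V\}.$$ If $V$, $H$, $\widetilde{H}$ are complex Hilbert spaces, $j \colon V \to H$ is continuous linear, $\tilde{j} \colon V \to \widetilde{H}$ is compact linear, and $\mathfrak{a}$, $\mathfrak{a}_n$ ($n \in \mathbb{N}$) are continuous symmetric sesquilinear forms on $V$ such that $(\mathfrak{a}_n)$ is uniformly $\tilde{j}$-elliptic and converges weakly to $\mathfrak{a}$, then $A$ and all $A_n$ are self-adjoint graphs, and for a self-adjoint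 graph $A$ and $s \in \mathbb{R}\setminus\{0\}$ the graph $A + isI = \{(x,y+isx) : (x,y) \in A\}$ is invertible: for every $y \in H$ there is a unique $x =: (A+isI)^{-1}y$ with $(x,y) \in A + isI$, and $(A+isI)^{-1}$ is a bounded operator on $H$. *)

theory Defs
  imports "HOL-Analysis.Analysis"
begin

(* The underlying real inner product of a complex inner product space is the real part of
   the complex one, so norm, topology and completeness are those of the library. *)
class complex_inner = real_inner +
  fixes scaleC :: "complex \<Rightarrow> 'a \<Rightarrow> 'a"  (infixr \<open>*\<^sub>C\<close> 75)
    and cinner :: "'a \<Rightarrow> 'a \<Rightarrow> complex"
  assumes scaleC_add_right: "c *\<^sub>C (x + y) = c *\<^sub>C x + c *\<^sub>C y"
    and scaleC_add_left: "(c + d) *\<^sub>C x = c *\<^sub>C x + d *\<^sub>C x"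
    and scaleC_scaleC: "c *\<^sub>C d *\<^sub>C x = (c * d) *\<^sub>C x"
    and scaleC_of_real: "complex_of_real r *\<^sub>C x = r *\<^sub>R x"
    and cinner_add_left: "cinner (x + y) z = cinner x z + cinner y z"
    and cinner_scaleC_left: "cinner (c *\<^sub>C x) y = c * cinner x y"
    and cinner_commute: "cinner x y = cnj (cinner y x)"
    and inner_eq_Re_cinner: "inner x y = Re (cinner x y)"

class chilbert_space = complex_inner + complete_space

instantiation complex :: chilbert_space
begin

definition scaleC_complex_def: "c *\<^sub>C (z :: complex) = c * z"

definition cinner_complex_def: "cinner z (w :: complex) = z * cnj w"

instance
  by standard
    (simp_all add: scaleC_complex_def cinner_complex_def inner_complex_def
      algebra_simps scaleR_conv_of_real)

end

definition clinear :: "('a::complex_inner \<Rightarrow> 'b::complex_inner) \<Rightarrow> bool" where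
  "clinear f \<longleftrightarrow> (\<forall>x y. f (x + y) = f x + f y) \<and> (\<forall>c x. f (c *\<^sub>C x) = c *\<^sub>C f x)"

definition continuous_clinear :: "('a::complex_inner \<Rightarrow> 'b::complex_inner) \<Rightarrow> bool" where
  "continuous_clinear f \<longleftrightarrow> clinear f \<and> continuous_on UNIV f"

definition compact_clinear :: "('a::complex_inner \<Rightarrow> 'b::complex_inner) \<Rightarrow> bool" where
  "compact_clinear f \<longleftrightarrow> clinear f \<and> (\<forall>B. bounded B \<longrightarrow> compact (closure (f ` B)))"

definition weakly_converges :: "(nat \<Rightarrow> 'a::complex_inner) \<Rightarrow> 'a \<Rightarrow> bool" where
  "weakly_converges u l \<longleftrightarrow>
     (\<forall>f :: 'a \<Rightarrow> complex. continuous_clinear f \<longrightarrow> (\<lambda>n. f (u n)) \<longlonglongrightarrow> f l)"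

definition sesquilinear :: "('a::complex_inner \<Rightarrow> 'a \<Rightarrow> complex) \<Rightarrow> bool" where
  "sesquilinear b \<longleftrightarrow>
     (\<forall>u u' v. b (u + u') v = b u v + b u' v) \<and>
     (\<forall>c u v. b (c *\<^sub>C u) v = c * b u v) \<and>
     (\<forall>u v v'. b u (v + v') = b u v + b u v') \<and>
     (\<forall>c u v. b u (c *\<^sub>C v) = cnj c * b u v)"

definition continuous_form :: "('a::complex_inner \<Rightarrow> 'a \<Rightarrow> complex) \<Rightarrow> bool" where
  "continuous_form b \<longleftrightarrow> continuous_on UNIV (\<lambda>(u, v). b u v)"

definition symmetric_form :: "('a::complex_inner \<Rightarrow> 'a \<Rightarrow> complex) \<Rightarrow> bool" where
  "symmetric_form b \<longleftrightarrow> (\<forall>u v. b u v = cnj (b v u))"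

(* The forms of interest are symmetric, so that b n u u is real; Re only adjusts the type. *)
definition uniformly_elliptic ::
    "(nat \<Rightarrow> 'v::complex_inner \<Rightarrow> 'v \<Rightarrow> complex) \<Rightarrow> ('v \<Rightarrow> 'k::complex_inner) \<Rightarrow> bool" where
  "uniformly_elliptic b jt \<longleftrightarrow>
     (\<exists>\<mu>>0. \<exists>\<omega>>0. \<forall>n u. Re (b n u u) + \<omega> * (norm (jt u))\<^sup>2 \<ge> \<mu> * (norm u)\<^sup>2)"

definition forms_converge_weakly ::
    "(nat \<Rightarrow> 'v::complex_inner \<Rightarrow> 'v \<Rightarrow> complex) \<Rightarrow> ('v \<Rightarrow> 'v \<Rightarrow> complex) \<Rightarrow> bool" where
  "forms_converge_weakly b a \<longleftrightarrow>
     (\<forall>v u us. weakly_converges us u \<longrightarrow> (\<lambda>n. b n (us n) v) \<longlonglongrightarrow> a u v)"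

definition W_form ::
    "('v::complex_inner \<Rightarrow> 'v \<Rightarrow> complex) \<Rightarrow> ('v \<Rightarrow> 'h::complex_inner) \<Rightarrow> 'v set" where
  "W_form a j = {u. j u = 0 \<and> (\<forall>v. a u v = 0)}"

definition assoc_graph ::
    "('v::complex_inner \<Rightarrow> 'v \<Rightarrow> complex) \<Rightarrow> ('v \<Rightarrow> 'h::complex_inner) \<Rightarrow> ('h \<times> 'h) set" where
  "assoc_graph b j = {(x, y). \<exists>u. j u = x \<and> (\<forall>v. b u v = cinner y (j v))}"

(* the graph G + c I *)
definition graph_shift :: "('h::complex_inner \<times> 'h) set \<Rightarrow> complex \<Rightarrow> ('h \<times> 'h) set" where
  "graph_shift G c = {(x, y + c *\<^sub>C x) | x y. (x, y) \<in> G}"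

(* meaningful only if every y is related to exactly one x, see graph_invertible *)
definition graph_inverse :: "('h \<times> 'h) set \<Rightarrow> 'h \<Rightarrow> 'h" where
  "graph_inverse G y = (THE x. (x, y) \<in> G)"

definition graph_invertible :: "('h::complex_inner \<times> 'h) set \<Rightarrow> bool" where
  "graph_invertible G \<longleftrightarrow>
     (\<forall>y. \<exists>!x. (x, y) \<in> G) \<and> continuous_clinear (graph_inverse G)"

end

theory Submission
  imports Defs "HOL-Library.Diagonal_Subsequence"
begin

text \<open>Write \<open>y\<close> for the datum and \<open>x\<close> for its image under the resolvent of the graph associated with
  a form \<open>b\<close>. Then \<open>x = j u\<close>, where \<open>u\<close> solves the variational equation
  \<open>b u v + i s (j u, j v) = (y, j v)\<close> for all \<open>v\<close>. As \<open>b\<close> is symmetric, the imaginary part of the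
  equation tested with \<open>u\<close> is \<open>s * (norm (j u))\<^sup>2 = Im (y, j u)\<close>. Thus \<open>j u\<close> is determined by \<open>y\<close>, the
  resolvent is bounded by \<open>1 / \<bar>s\<bar>\<close>, and the solutions for \<open>y = 0\<close> form the space \<open>W\<close> of the form.

  Everything else rests on one compactness statement, \<open>solutions_weakly_subconvergent\<close>: solutions of
  such equations for weakly converging, uniformly elliptic forms and bounded, weakly
  converging data are bounded, and a subsequence converges weakly to a solution of the limit equation,
  provided that they stay orthogonal to a set whose orthogonal complement meets the kernel of the limit form
  only in \<open>0\<close>. It is proved by contradiction, normalising an unbounded sequence of solutions and using that
  weak convergence becomes norm convergence under the compact map \<open>jt\<close>.

  It is used twice. For a fixed form it gives solvability: the equation perturbed by \<open>i e (u, v)\<close> with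
  a small number \<open>e\<close> of the sign of \<open>s\<close> is solvable by the Lax--Milgram lemma, its solutions are orthogonal
  to \<open>W\<close>, and \<open>e\<close> may tend to \<open>0\<close> (\<open>elliptic_form.solvable\<close>). For the sequence of forms, where
  the kernel of the limit is \<open>{0}\<close>, it gives weak convergence \<open>j (u n)\<close> to \<open>j u\<close> along
  subsequences. For fixed \<open>y\<close> the identity above shows that the norms converge as well, hence strong convergence
  holds. If \<open>j\<close> is compact, \<open>j (u n)\<close> converges in norm even for data that converge only weakly
  (\<open>resolvents_tendsto\<close>), and choosing data that nearly realise the operator norm of the difference of the
  resolvents yields convergence in operator norm (\<open>resolvents_onorm_tendsto\<close>).

  The tools from Hilbert space theory are derived from the minimisation of a quadratic functional
  on a closed subspace (\<open>riesz_on_closed_subspace\<close>).\<close>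

section \<open>Real Hilbert spaces\<close>

text \<open>The Dirichlet principle: the functional \<open>\<lambda>x. inner x x - 2 * f x\<close> attains its minimum on a
  closed subspace, because the parallelogram identity makes every minimising sequence a Cauchy
  sequence, and the vanishing first variation at the minimiser is the asserted identity.
  For \<open>f = inner v\<close> the point obtained is the orthogonal projection of \<open>v\<close> to \<open>D\<close>.\<close>

lemma riesz_on_closed_subspace:
  fixes D :: "'a::{real_inner, complete_space} set"
  assumes D: "subspace D" and clD: "closed D" and f: "bounded_linear f"
  obtains p where "p \<in> D" and "\<And>x. x \<in> D \<Longrightarrow> inner p x = f x"
proof -
  interpret f: bounded_linear f by fact
  define J where "J x = inner x x - 2 * f x" for x
  obtain K where K: "\<And>x. \<bar>f x\<bar> \<le> norm x * K" and "K \<ge> 0"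
    using f.nonneg_bounded by (auto simp: real_norm_def)
  have J_lower: "J x \<ge> - (K^2)" for x
  proof -
    have "0 \<le> (norm x - K)^2" by simp
    then have "2 * (norm x * K) \<le> (norm x)^2 + K^2" by (simp add: power2_diff mult.assoc)
    with K[of x] show ?thesis
      unfolding J_def by (simp add: power2_norm_eq_inner)
  qed
  define m where "m = Inf (J ` D)"
  have bdd: "bdd_below (J ` D)" using J_lower by (auto intro!: bdd_belowI)
  have m_le: "m \<le> J x" if "x \<in> D" for x
    unfolding m_def by (rule cInf_lower[OF _ bdd]) (use that in auto)
  have "\<exists>x\<in>D. J x < m + 1 / real (Suc n)" for n
    using cInf_lessD[of "J ` D" "m + 1 / real (Suc n)"] subspace_0[OF D] unfolding m_def by auto
  then obtain x where xD: "\<And>n. x n \<in> D" and xJ: "\<And>n. J (x n) < m + 1 / real (Suc n)"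
    by metis
  have gap: "(dist (x k) (x l))^2 \<le> 2 / real (Suc k) + 2 / real (Suc l)" for k l
  proof -
    let ?z = "(1/2) *\<^sub>R (x k + x l)"
    have "?z \<in> D" using D xD by (simp add: subspace_add subspace_scale)
    then have "m \<le> J ?z" by (rule m_le)
    moreover have "(dist (x k) (x l))^2 = 2 * J (x k) + 2 * J (x l) - 4 * J ?z"
      unfolding J_def dist_norm power2_norm_eq_inner
      by (simp add: f.add f.scaleR inner_add_left inner_add_right inner_diff_left
          inner_diff_right inner_commute algebra_simps)
    ultimately show ?thesis using xJ[of k] xJ[of l] by (simp add: algebra_simps)
  qed
  have "Cauchy x"
  proof (rule metric_CauchyI)
    fix e :: real assume e: "e > 0"
    obtain N where N: "inverse (real (Suc N)) < e^2 / 4"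
      using reals_Archimedean[of "e^2/4"] e by auto
    have "dist (x k) (x l) < e" if "k \<ge> N" "l \<ge> N" for k l
    proof -
      have "2 / real (Suc k) \<le> 2 / real (Suc N)" "2 / real (Suc l) \<le> 2 / real (Suc N)"
        using that by (simp_all add: frac_le)
      moreover have "2 / real (Suc N) < e^2 / 2" using N by (simp add: field_simps)
      ultimately have "(dist (x k) (x l))^2 < e^2" using gap[of k l] by linarith
      then show ?thesis by (rule power_less_imp_less_base) (use e in simp)
    qed
    then show "\<exists>M. \<forall>k\<ge>M. \<forall>l\<ge>M. dist (x k) (x l) < e" by blast
  qed
  then obtain p where p: "x \<longlonglongrightarrow> p" using Cauchy_convergent_iff convergent_def by blast
  have pD: "p \<in> D" using closed_sequentially[OF clD] xD p by blast
  have "(\<lambda>n. J (x n)) \<longlonglongrightarrow> J p"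
    unfolding J_def by (intro tendsto_intros f.tendsto p)
  moreover have "(\<lambda>n. m + 1 / real (Suc n)) \<longlonglongrightarrow> m + 0"
    using LIMSEQ_inverse_real_of_nat by (intro tendsto_intros) (simp add: divide_inverse)
  ultimately have Jp: "J p \<le> m"
    using LIMSEQ_le[of "\<lambda>n. J (x n)" "J p" "\<lambda>n. m + 1 / real (Suc n)" "m + 0"]
      xJ less_imp_le by auto
  have "inner p y = f y" if y: "y \<in> D" for y
  proof (cases "y = 0")
    case False
    define d where "d = inner p y - f y"
    define t where "t = - d / inner y y"
    have yy: "inner y y > 0" using False by simp
    have "p + t *\<^sub>R y \<in> D" using D pD y by (simp add: subspace_add subspace_scale)
    then have "J p \<le> J (p + t *\<^sub>R y)" using m_le Jp by fastforce
    also have "J (p + t *\<^sub>R y) = J p + 2 * t * d + t^2 * inner y y"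
      unfolding J_def d_def by (simp add: f.add f.scaleR inner_add_left inner_add_right
          inner_commute power2_eq_square algebra_simps)
    finally have "0 \<le> 2 * t * d + t^2 * inner y y" by simp
    also have "2 * t * d + t^2 * inner y y = - (d^2 / inner y y)"
      unfolding t_def using yy by (simp add: power2_eq_square field_simps)
    finally have "d^2 / inner y y \<le> 0" by linarith
    then have "d = 0" using yy by (simp add: divide_le_0_iff)
    then show ?thesis by (simp add: d_def)
  qed (simp add: f.zero)
  with pD show thesis using that by blast
qed

text \<open>The Lax--Milgram lemma. Representing \<open>B u\<close> and \<open>f\<close> by vectors \<open>T u\<close> and \<open>g\<close> reduces the
  equation to \<open>T u = g\<close>, and coercivity makes \<open>\<lambda>u. u - r *\<^sub>R (T u - g)\<close> a contraction
  for small \<open>r > 0\<close>.\<close>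

lemma lax_milgram_real:
  fixes B :: "'a::{real_inner, complete_space} \<Rightarrow> 'a \<Rightarrow> real"
  assumes B: "bounded_bilinear B" and e: "e > 0" and coercive: "\<And>u. B u u \<ge> e * (norm u)^2"
    and f: "bounded_linear f"
  obtains u where "\<And>v. B u v = f v"
proof -
  interpret B: bounded_bilinear B by fact
  have "\<exists>z. \<forall>v. inner z v = B u v" for u
    using riesz_on_closed_subspace[OF subspace_UNIV closed_UNIV B.bounded_linear_right[of u]] by auto
  then obtain T where T: "\<And>u v. inner (T u) v = B u v" by metis
  obtain g where g: "\<And>v. inner g v = f v"
    using riesz_on_closed_subspace[OF subspace_UNIV closed_UNIV f] by auto
  obtain K0 where K0: "\<And>u v. norm (B u v) \<le> norm u * norm v * K0" and "K0 > 0"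
    using B.pos_bounded by auto
  define K where "K = max K0 e"
  have K: "K > 0" "K \<ge> e" "K \<ge> K0" unfolding K_def using e by auto
  have T_diff: "norm (T u - T w) \<le> K * norm (u - w)" for u w
  proof -
    let ?v = "T u - T w"
    have "(norm ?v)^2 = B (u - w) ?v"
      by (simp add: power2_norm_eq_inner inner_diff_left T B.diff_left)
    also have "\<dots> \<le> norm (u - w) * norm ?v * K0" using K0[of "u - w" ?v] by simp
    also have "\<dots> \<le> norm (u - w) * norm ?v * K" using K by (intro mult_left_mono) auto
    finally have "norm ?v * norm ?v \<le> (K * norm (u - w)) * norm ?v"
      by (simp add: power2_eq_square mult_ac)
    then show ?thesis
      using K by (cases "norm ?v = 0") (auto dest: mult_right_le_imp_le)
  qed
  \<comment> \<open>This \<open>r\<close> minimises \<open>1 - 2 * r * e + r\<^sup>2 * K\<^sup>2\<close>, the square of the contraction factor.\<close>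
  define r where "r = e / K^2"
  define q where "q = sqrt (1 - (e / K)^2)"
  have eK: "0 < e / K" "e / K \<le> 1" using e K by auto
  then have eK2: "0 < (e / K)^2" "(e / K)^2 \<le> 1" by (auto simp: power_le_one)
  define \<Phi> where "\<Phi> u = u - r *\<^sub>R (T u - g)" for u
  have "dist (\<Phi> u) (\<Phi> w) \<le> q * dist u w" for u w
  proof -
    let ?d = "u - w" and ?T = "T u - T w"
    have "(norm (?d - r *\<^sub>R ?T))^2 = (norm ?d)^2 - 2 * r * inner ?T ?d + r^2 * (norm ?T)^2"
      unfolding power2_norm_eq_inner
      by (simp add: inner_diff_left inner_diff_right inner_commute power2_eq_square algebra_simps)
    also have "inner ?T ?d = B ?d ?d" by (simp add: inner_diff_left T B.diff_left)
    also have "(norm ?d)^2 - 2 * r * B ?d ?d + r^2 * (norm ?T)^2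
        \<le> (norm ?d)^2 - 2 * r * (e * (norm ?d)^2) + r^2 * (K * norm ?d)^2"
      using coercive[of ?d] T_diff[of u w] e K
      by (intro add_mono diff_mono mult_left_mono power_mono) (auto simp: r_def)
    also have "\<dots> = (1 - (e / K)^2) * (norm ?d)^2"
      unfolding r_def using K by (simp add: field_simps power2_eq_square)
    also have "\<dots> = (q * norm ?d)^2"
      using eK2 unfolding q_def by (simp add: power_mult_distrib)
    finally have "norm (?d - r *\<^sub>R ?T) \<le> q * norm ?d"
      by (rule power2_le_imp_le) (use eK2 in \<open>simp add: q_def\<close>)
    moreover have "\<Phi> u - \<Phi> w = ?d - r *\<^sub>R ?T" by (simp add: \<Phi>_def algebra_simps)
    ultimately show ?thesis by (simp add: dist_norm)
  qed
  moreover have "0 \<le> q" "q < 1" unfolding q_def using eK2 by auto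
  ultimately obtain u where "\<Phi> u = u" using banach_fix_type[of q \<Phi>] by auto
  then have "T u = g" using e K by (simp add: \<Phi>_def r_def)
  then have "B u v = f v" for v using T[of u v] g[of v] by simp
  then show thesis using that by blast
qed

text \<open>Weak sequential compactness of bounded sets. A diagonal argument yields a subsequence along
  which the inner products with all members of the sequence converge. The vectors with
  this property form a closed subspace \<open>D\<close> containing the sequence, and the inner products
  with a vector do not change when it is projected to \<open>D\<close>; hence \<open>D\<close> is the whole space.\<close>

lemma bounded_weakly_convergent_subsequence_real:
  fixes u :: "nat \<Rightarrow> 'a::{real_inner, complete_space}"
  assumes bnd: "\<And>n. norm (u n) \<le> C"
  obtains r l where "strict_mono r" and "\<And>v. (\<lambda>n. inner (u (r n)) v) \<longlonglongrightarrow> inner l v"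
proof -
  have C: "C \<ge> 0" using bnd[of 0] norm_ge_zero order_trans by blast
  have ub: "\<bar>inner (u n) v\<bar> \<le> C * norm v" for n v
    using Cauchy_Schwarz_ineq2[of "u n" v] mult_right_mono[OF bnd[of n] norm_ge_zero[of v]]
    by linarith
  interpret subseqs "\<lambda>k s. convergent (\<lambda>n. inner (u (s n)) (u k))"
  proof
    fix k and s :: "nat \<Rightarrow> nat" assume "strict_mono s"
    have "bounded (range (\<lambda>n. inner (u (s n)) (u k)))"
      using ub by (auto simp: bounded_iff intro!: exI[of _ "C * norm (u k)"])
    then obtain l r' where "strict_mono (r' :: nat \<Rightarrow> nat)"
        "((\<lambda>n. inner (u (s n)) (u k)) \<circ> r') \<longlonglongrightarrow> l"
      using bounded_imp_convergent_subsequence by blast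
    then show "\<exists>r'. strict_mono r' \<and> convergent (\<lambda>n. inner (u ((s \<circ> r') n)) (u k))"
      by (auto simp: convergent_def o_def)
  qed
  define g where "g n = u (diagseq n)" for n
  have diag: "convergent (\<lambda>n. inner (u ((diagseq \<circ> ((+) (Suc k))) n)) (u k))" for k
  proof (rule diagseq_holds)
    fix s r :: "nat \<Rightarrow> nat" and n
    assume "strict_mono r" and "convergent (\<lambda>i. inner (u (s i)) (u n))"
    then show "convergent (\<lambda>i. inner (u ((s \<circ> r) i)) (u n))"
      using convergent_subseq_convergent[of "\<lambda>i. inner (u (s i)) (u n)" r] by (simp add: o_def)
  qed
  have conv_u: "convergent (\<lambda>n. inner (g n) (u k))" for k
    by (subst convergent_ignore_initial_segment[symmetric, of _ "Suc k"])
      (use diag[of k] in \<open>simp add: g_def o_def add.commute[of _ k]\<close>)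
  have gb: "\<bar>inner (g n) v\<bar> \<le> C * norm v" for n v using ub by (simp add: g_def)
  define D where "D = {v. convergent (\<lambda>n. inner (g n) v)}"
  have D: "subspace D"
    unfolding subspace_def D_def
    by (auto simp: inner_add_right convergent_const intro!: convergent_add convergent_mult)
  have "closed D"
  proof (unfold closed_sequential_limits, intro allI impI, elim conjE)
    fix v l assume vD: "\<forall>k. v k \<in> D" and v: "v \<longlonglongrightarrow> l"
    have "Cauchy (\<lambda>n. inner (g n) l)"
    proof (rule metric_CauchyI)
      fix e :: real assume e: "e > 0"
      then have "e / (3 * (C + 1)) > 0" using C by simp
      then obtain k where "norm (v k - l) < e / (3 * (C + 1))"
        using v by (meson LIMSEQ_iff order_refl)
      then have "(C + 1) * norm (v k - l) < e / 3" using C by (simp add: field_simps)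
      moreover have "C * norm (v k - l) \<le> (C + 1) * norm (v k - l)" by (simp add: algebra_simps)
      ultimately have small: "\<bar>inner (g n) (v k - l)\<bar> < e / 3" for n
        using gb[of n "v k - l"] by linarith
      have "Cauchy (\<lambda>n. inner (g n) (v k))"
        using vD by (auto simp: D_def intro: convergent_Cauchy)
      then obtain M where M: "\<And>m n. m \<ge> M \<Longrightarrow> n \<ge> M \<Longrightarrow>
          dist (inner (g m) (v k)) (inner (g n) (v k)) < e / 3"
        using e unfolding Cauchy_def by (meson divide_pos_pos zero_less_numeral)
      have "dist (inner (g m) l) (inner (g n) l) < e" if "m \<ge> M" "n \<ge> M" for m n
        using M[OF that] small[of m] small[of n]
        by (simp add: dist_real_def inner_diff_right abs_if split: if_splits)
      then show "\<exists>M. \<forall>m\<ge>M. \<forall>n\<ge>M. dist (inner (g m) l) (inner (g n) l) < e" by blast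
    qed
    then show "l \<in> D" by (simp add: D_def Cauchy_convergent_iff)
  qed
  have all: "convergent (\<lambda>n. inner (g n) v)" for v
  proof -
    obtain p where p: "p \<in> D" "\<And>x. x \<in> D \<Longrightarrow> inner p x = inner v x"
      using riesz_on_closed_subspace[OF D \<open>closed D\<close> bounded_linear_inner_right[of v]] by auto
    have "inner (g n) v = inner (g n) p" for n
      using p(2)[of "g n"] conv_u[of "diagseq n"]
      by (simp add: D_def g_def inner_commute[of v] inner_commute[of p])
    with p(1) show ?thesis by (simp add: D_def)
  qed
  define L where "L v = lim (\<lambda>n. inner (g n) v)" for v
  have L: "(\<lambda>n. inner (g n) v) \<longlonglongrightarrow> L v" for v
    using all unfolding L_def by (simp add: convergent_LIMSEQ_iff)
  have "bounded_linear L"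
  proof
    show "L (x + y) = L x + L y" for x y
      by (rule LIMSEQ_unique[OF L]) (simp add: inner_add_right tendsto_add L)
    show "L (t *\<^sub>R x) = t *\<^sub>R L x" for t x
      by (rule LIMSEQ_unique[OF L]) (simp add: tendsto_mult_left L)
    show "\<exists>K. \<forall>x. norm (L x) \<le> norm x * K"
    proof (intro exI allI)
      fix x show "norm (L x) \<le> norm x * C"
        by (rule LIMSEQ_le_const2[OF tendsto_norm[OF L]]) (use gb in \<open>auto simp: mult.commute\<close>)
    qed
  qed
  then obtain l where "\<And>v. inner l v = L v"
    using riesz_on_closed_subspace[OF subspace_UNIV closed_UNIV] by auto
  then have "(\<lambda>n. inner (u (diagseq n)) v) \<longlonglongrightarrow> inner l v" for v using L[of v] by (simp add: g_def)
  then show thesis using that[OF subseq_diagseq] by blast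
qed

section \<open>Complex Hilbert spaces and weak convergence\<close>

lemma scaleC_minus_one [simp]: "(- 1) *\<^sub>C (x :: 'a::complex_inner) = - x"
  using scaleC_of_real[of "-1" x] by simp

lemma cinner_scaleC_right: "cinner x (c *\<^sub>C y) = cnj c * cinner x y"
  by (metis cinner_commute cinner_scaleC_left complex_cnj_mult)

lemma cinner_add_right: "cinner x (y + z) = cinner x y + cinner x z"
  by (metis cinner_commute cinner_add_left complex_cnj_add)

text \<open>Continuity and weak convergence of complex inner products reduce to the real case by this
  identity.\<close>

lemma cinner_eq_Complex: "cinner x y = Complex (inner x y) (inner x (\<i> *\<^sub>C y))"
  by (rule complex_eqI) (simp_all add: inner_eq_Re_cinner cinner_scaleC_right)

lemma Im_cinner: "Im (cinner x y) = inner x (\<i> *\<^sub>C y)"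
  by (simp add: cinner_eq_Complex)

lemma cinner_self: "cinner x x = of_real ((norm x)\<^sup>2)"
proof (rule complex_eqI)
  show "Re (cinner x x) = Re (of_real ((norm x)\<^sup>2))"
    by (simp add: inner_eq_Re_cinner[symmetric] power2_norm_eq_inner)
  have "Im (cinner x x) = - Im (cinner x x)"
    by (subst cinner_commute) (simp only: cnj.sel)
  then show "Im (cinner x x) = Im (of_real ((norm x)\<^sup>2))" by simp
qed

lemma norm_imaginary_scaleC [simp]: "norm (\<i> *\<^sub>C x) = norm (x :: 'a::complex_inner)"
proof -
  have "cinner (\<i> *\<^sub>C x) (\<i> *\<^sub>C x) = cinner x x"
    by (simp add: cinner_scaleC_left cinner_scaleC_right)
  then have "(norm (\<i> *\<^sub>C x))\<^sup>2 = (norm x)\<^sup>2"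
    unfolding cinner_self of_real_eq_iff .
  then show ?thesis by simp
qed

lemma cinner_diff_left: "cinner (x - y) z = cinner x z - cinner y z"
  using cinner_add_left[of "x - y" y z] by simp

lemma cinner_diff_right: "cinner z (x - y) = cinner z x - cinner z y"
  using cinner_add_right[of z "x - y" y] by simp

lemma cinner_zero_left [simp]: "cinner 0 z = 0"
  using cinner_diff_left[of 0 0 z] by simp

lemma cinner_zero_right [simp]: "cinner z 0 = 0"
  using cinner_diff_right[of z 0 0] by simp

lemma bounded_linear_scaleC_imaginary: "bounded_linear (\<lambda>x :: 'a::complex_inner. \<i> *\<^sub>C x)"
proof (rule bounded_linear_intro[where K = 1])
  show "\<i> *\<^sub>C (t *\<^sub>R x) = t *\<^sub>R (\<i> *\<^sub>C x)" for t and x :: 'a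
    by (simp add: scaleC_of_real[symmetric] scaleC_scaleC mult.commute)
qed (simp_all add: scaleC_add_right)

lemma continuous_on_cinner [continuous_intros]:
  assumes "continuous_on S f" "continuous_on S g"
  shows "continuous_on S (\<lambda>x. cinner (f x) (g x))"
  unfolding cinner_eq_Complex Complex_eq using assms
  by (intro continuous_intros bounded_linear.continuous_on[OF bounded_linear_scaleC_imaginary])

lemma clinear_imp_linear: "clinear f \<Longrightarrow> linear f"
  by (intro linearI) (simp_all add: clinear_def scaleC_of_real[symmetric])

lemma continuous_clinear_bounded_linear:
  assumes "continuous_clinear f" shows "bounded_linear f"
proof -
  have lin: "linear f" and cont: "isCont f 0"
    using assms by (auto simp: continuous_clinear_def clinear_imp_linear continuous_on_eq_continuous_at)
  interpret f: linear f by fact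
  obtain d where d: "d > 0" "\<And>x. dist x 0 < d \<Longrightarrow> dist (f x) (f 0) < 1"
    using cont unfolding continuous_at_eps_delta by (meson zero_less_one)
  have "norm (f x) \<le> norm x * (2 / d)" for x
  proof (cases "x = 0")
    case False
    define t where "t = d / (2 * norm x)"
    have t: "t > 0" using d False by (simp add: t_def)
    have "norm (f (t *\<^sub>R x)) < 1" using d(2)[of "t *\<^sub>R x"] d(1) False by (simp add: t_def f.zero)
    then have "t * norm (f x) < 1" using t by (simp add: f.scaleR)
    then show ?thesis using d(1) False by (simp add: t_def field_simps)
  qed (simp add: f.zero)
  then show ?thesis by (intro bounded_linear_intro f.add f.scale)
qed

lemma bounded_linear_clinear_continuous:
  "clinear f \<Longrightarrow> bounded_linear f \<Longrightarrow> continuous_clinear f"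
  by (simp add: continuous_clinear_def linear_continuous_on)

lemma compact_clinear_continuous:
  assumes "compact_clinear K" shows "continuous_clinear K"
proof -
  have lin: "clinear K" and "compact (closure (K ` cball 0 1))"
    using assms by (auto simp: compact_clinear_def)
  interpret K: linear K by (rule clinear_imp_linear) fact
  have "bounded (K ` cball 0 1)"
    using \<open>compact (closure (K ` cball 0 1))\<close> compact_imp_bounded bounded_subset closure_subset by blast
  then obtain C where C: "\<And>x. norm x \<le> 1 \<Longrightarrow> norm (K x) \<le> C"
    unfolding bounded_iff by (meson imageI mem_cball_0)
  have "norm (K x) \<le> norm x * C" for x
  proof (cases "x = 0")
    case False
    then show ?thesis using C[of "x /\<^sub>R norm x"] by (simp add: K.scaleR field_simps)
  qed (simp add: K.zero)
  then have "bounded_linear K" by (intro bounded_linear_intro K.add K.scale)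
  with lin show ?thesis by (rule bounded_linear_clinear_continuous)
qed

text \<open>The complex Riesz theorem follows from the real one, as the real part of a functional
  determines it.\<close>

lemma continuous_clinear_functional_riesz:
  fixes f :: "'a::chilbert_space \<Rightarrow> complex"
  assumes f: "continuous_clinear f"
  obtains z where "\<And>x. f x = cinner x z"
proof -
  have "bounded_linear (\<lambda>x. Re (f x))"
    using continuous_clinear_bounded_linear[OF f] by (rule bounded_linear_compose[OF bounded_linear_Re])
  then obtain z where z: "\<And>x. inner z x = Re (f x)"
    using riesz_on_closed_subspace[OF subspace_UNIV closed_UNIV] by (metis UNIV_I)
  have "f x = cinner x z" for x
  proof (rule complex_eqI)
    have Re: "Re (f x) = Re (cinner x z)" for x
      using z[of x] by (simp add: inner_commute inner_eq_Re_cinner[symmetric])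
    have "f (\<i> *\<^sub>C x) = \<i> * f x"
      using f by (simp add: continuous_clinear_def clinear_def scaleC_complex_def)
    then show "Im (f x) = Im (cinner x z)"
      using Re[of "\<i> *\<^sub>C x"] by (simp add: cinner_scaleC_left)
    show "Re (f x) = Re (cinner x z)" by (rule Re)
  qed
  then show thesis by (rule that)
qed

lemma continuous_clinear_cinner: "continuous_clinear (\<lambda>x. cinner x z)"
  unfolding continuous_clinear_def clinear_def
  by (intro conjI allI continuous_intros) (simp_all add: cinner_add_left cinner_scaleC_left scaleC_complex_def)

text \<open>By the Riesz theorem, weak convergence may be tested with real inner products, the form
  in which the weak compactness theorem delivers it.\<close>

lemma weakly_converges_iff_inner:
  fixes l :: "'a::chilbert_space"
  shows "weakly_converges u l \<longleftrightarrow> (\<forall>z. (\<lambda>n. inner (u n) z) \<longlonglongrightarrow> inner l z)"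
proof (intro iffI allI)
  fix z assume "weakly_converges u l"
  then have "(\<lambda>n. cinner (u n) z) \<longlonglongrightarrow> cinner l z"
    using continuous_clinear_cinner unfolding weakly_converges_def by blast
  then show "(\<lambda>n. inner (u n) z) \<longlonglongrightarrow> inner l z"
    unfolding inner_eq_Re_cinner by (rule tendsto_Re)
next
  assume inner: "\<forall>z. (\<lambda>n. inner (u n) z) \<longlonglongrightarrow> inner l z"
  show "weakly_converges u l" unfolding weakly_converges_def
  proof (intro allI impI)
    fix f :: "'a \<Rightarrow> complex" assume "continuous_clinear f"
    then obtain z where "\<And>x. f x = cinner x z" using continuous_clinear_functional_riesz by blast
    then show "(\<lambda>n. f (u n)) \<longlonglongrightarrow> f l"
      using inner by (simp add: cinner_eq_Complex tendsto_Complex)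
  qed
qed

lemma weakly_converges_cinner:
  assumes "weakly_converges u l" shows "(\<lambda>n. cinner (u n) z) \<longlonglongrightarrow> cinner l z"
  using assms continuous_clinear_cinner unfolding weakly_converges_def by blast

lemma weakly_converges_const: "weakly_converges (\<lambda>n. l) l"
  by (simp add: weakly_converges_def)

lemma weakly_converges_subseq:
  fixes l :: "'a::complex_inner"
  assumes "weakly_converges u l" "strict_mono r" shows "weakly_converges (\<lambda>n. u (r n)) l"
  unfolding weakly_converges_def
proof (intro allI impI)
  fix f :: "'a \<Rightarrow> complex" assume "continuous_clinear f"
  then have "(\<lambda>n. f (u n)) \<longlonglongrightarrow> f l" using assms(1) by (simp add: weakly_converges_def)
  then show "(\<lambda>n. f (u (r n))) \<longlonglongrightarrow> f l"
    using assms(2) filterlim_compose filterlim_subseq by blast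
qed

lemma continuous_clinear_compose:
  assumes "continuous_clinear f" "continuous_clinear g"
  shows "continuous_clinear (\<lambda>x. g (f x))"
  using assms continuous_on_compose2[of UNIV g UNIV f]
  by (simp add: continuous_clinear_def clinear_def)

lemma weakly_converges_continuous_clinear:
  fixes f :: "'a::complex_inner \<Rightarrow> 'b::complex_inner"
  assumes "weakly_converges u l" "continuous_clinear f"
  shows "weakly_converges (\<lambda>n. f (u n)) (f l)"
  unfolding weakly_converges_def
proof (intro allI impI)
  fix g :: "'b \<Rightarrow> complex" assume "continuous_clinear g"
  then show "(\<lambda>n. g (f (u n))) \<longlonglongrightarrow> g (f l)"
    using assms continuous_clinear_compose[of f g] by (auto simp: weakly_converges_def)
qed

lemma tendsto_imp_weakly_converges: "u \<longlonglongrightarrow> l \<Longrightarrow> weakly_converges u l"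
  unfolding weakly_converges_def continuous_clinear_def
  by (simp add: continuous_on_eq_continuous_at isCont_tendsto_compose)

lemma weakly_converges_unique:
  fixes l :: "'a::complex_inner"
  assumes "weakly_converges u l" "weakly_converges u l'" shows "l = l'"
proof -
  have "cinner l (l - l') = cinner l' (l - l')"
    using assms[THEN weakly_converges_cinner] by (rule LIMSEQ_unique)
  then have "cinner (l - l') (l - l') = 0" by (simp add: cinner_diff_left)
  then show ?thesis by (simp add: cinner_self)
qed

lemma bounded_weakly_convergent_subsequence:
  fixes u :: "nat \<Rightarrow> 'a::chilbert_space"
  assumes "\<And>n. norm (u n) \<le> C"
  obtains r l where "strict_mono r" and "weakly_converges (\<lambda>n. u (r n)) l"
proof -
  obtain r l where r: "strict_mono r" and "\<And>v. (\<lambda>n. inner (u (r n)) v) \<longlonglongrightarrow> inner l v"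
    using assms by (rule bounded_weakly_convergent_subsequence_real[of u C]) blast
  then have "weakly_converges (\<lambda>n. u (r n)) l" by (simp add: weakly_converges_iff_inner)
  with r show thesis by (rule that)
qed

lemma tendsto_if_all_subseqs:
  fixes x :: "nat \<Rightarrow> 'a::metric_space"
  assumes "\<And>r. strict_mono r \<Longrightarrow> \<exists>q. strict_mono (q :: nat \<Rightarrow> nat) \<and> (\<lambda>n. x (r (q n))) \<longlonglongrightarrow> l"
  shows "x \<longlonglongrightarrow> l"
proof (rule ccontr)
  assume "\<not> x \<longlonglongrightarrow> l"
  then obtain e where e: "e > 0" and "\<And>N. \<exists>n\<ge>N. \<not> dist (x n) l < e"
    unfolding lim_sequentially by blast
  then have "infinite {n. \<not> dist (x n) l < e}"
    unfolding infinite_nat_iff_unbounded_le by blast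
  then obtain r where r: "strict_mono (r :: nat \<Rightarrow> nat)" "\<And>n. \<not> dist (x (r n)) l < e"
    using infinite_enumerate by blast
  obtain q where "(\<lambda>n. x (r (q n))) \<longlonglongrightarrow> l" using assms[OF r(1)] by blast
  with e r(2) show False unfolding lim_sequentially by blast
qed

text \<open>Images of a bounded sequence under a compact map have norm convergent subsequences, and their limits
  must agree with the weak limit \<open>K l\<close>.\<close>

lemma compact_clinear_weakly_to_strongly:
  assumes K: "compact_clinear K" and u: "weakly_converges u l" and bnd: "\<And>n. norm (u n) \<le> C"
  shows "(\<lambda>n. K (u n)) \<longlonglongrightarrow> K l"
proof (rule tendsto_if_all_subseqs)
  fix r :: "nat \<Rightarrow> nat" assume r: "strict_mono r"
  have "compact (closure (K ` cball 0 C))" using K by (simp add: compact_clinear_def)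
  moreover have "K (u (r n)) \<in> closure (K ` cball 0 C)" for n
    using bnd by (intro closure_subset[THEN subsetD]) auto
  ultimately have "\<exists>z\<in>closure (K ` cball 0 C). \<exists>q. strict_mono q \<and> ((\<lambda>n. K (u (r n))) \<circ> q) \<longlonglongrightarrow> z"
    unfolding compact_def by simp
  then obtain z q where q: "strict_mono (q :: nat \<Rightarrow> nat)" "(\<lambda>n. K (u (r (q n)))) \<longlonglongrightarrow> z"
    by (auto simp: o_def)
  have "weakly_converges (\<lambda>n. K (u (r (q n)))) (K l)"
    using weakly_converges_continuous_clinear[OF u compact_clinear_continuous[OF K]]
      weakly_converges_subseq[of "\<lambda>n. K (u n)" "K l" "r \<circ> q"] strict_mono_o[OF r q(1)]
    by (simp add: o_def)
  then have "z = K l"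
    by (rule weakly_converges_unique[OF tendsto_imp_weakly_converges[OF q(2)]])
  with q show "\<exists>q. strict_mono q \<and> (\<lambda>n. K (u (r (q n)))) \<longlonglongrightarrow> K l" by blast
qed

text \<open>Weak convergence and convergence of the norms give norm convergence, by
  expanding the square \<open>(norm (u n - l))\<^sup>2\<close>.\<close>

lemma weakly_converges_norm_imp_tendsto:
  fixes l :: "'a::chilbert_space"
  assumes u: "weakly_converges u l" and norms: "(\<lambda>n. (norm (u n))\<^sup>2) \<longlonglongrightarrow> (norm l)\<^sup>2"
  shows "u \<longlonglongrightarrow> l"
proof -
  have "(\<lambda>n. inner (u n) l) \<longlonglongrightarrow> inner l l" using u by (simp add: weakly_converges_iff_inner)
  then have "(\<lambda>n. (norm (u n))\<^sup>2 - 2 * inner (u n) l + (norm l)\<^sup>2)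
      \<longlonglongrightarrow> (norm l)\<^sup>2 - 2 * inner l l + (norm l)\<^sup>2"
    by (intro tendsto_add tendsto_diff tendsto_mult_left tendsto_const norms)
  moreover have "(norm (u n))\<^sup>2 - 2 * inner (u n) l + (norm l)\<^sup>2 = (norm (u n - l))\<^sup>2" for n
    by (simp add: power2_norm_eq_inner inner_diff_left inner_diff_right inner_commute)
  ultimately have "(\<lambda>n. (norm (u n - l))\<^sup>2) \<longlonglongrightarrow> 0"
    by (simp add: power2_norm_eq_inner)
  then have "(\<lambda>n. norm (u n - l)) \<longlonglongrightarrow> 0"
    using tendsto_real_sqrt[of "\<lambda>n. (norm (u n - l))\<^sup>2" 0] by simp
  then show ?thesis by (simp add: tendsto_norm_zero_iff LIM_zero_iff)
qed

section \<open>Sesquilinear forms\<close>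

lemma sesquilinear_scaleR_left: "sesquilinear b \<Longrightarrow> b (t *\<^sub>R u) v = of_real t * b u v"
  by (simp add: sesquilinear_def scaleC_of_real[symmetric])

lemma sesquilinear_scaleR_right: "sesquilinear b \<Longrightarrow> b u (t *\<^sub>R v) = of_real t * b u v"
  by (simp add: sesquilinear_def scaleC_of_real[symmetric])

lemma continuous_sesquilinear_bounded:
  fixes b :: "'v::complex_inner \<Rightarrow> 'v \<Rightarrow> complex"
  assumes b: "sesquilinear b" and cont: "continuous_form b"
  obtains C where "\<And>u v. norm (b u v) \<le> norm u * norm v * C"
proof -
  have scale: "b (s *\<^sub>R u) (t *\<^sub>R v) = of_real (s * t) * b u v" for s t u v
    by (simp add: sesquilinear_scaleR_left[OF b] sesquilinear_scaleR_right[OF b])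
  have zero: "b 0 0 = 0" using scale[of 0 0 0 0] by simp
  have "isCont (\<lambda>(u, v). b u v) (0, 0)"
    using cont by (simp add: continuous_form_def continuous_on_eq_continuous_at)
  then obtain d where d: "d > 0"
    "\<And>p. dist p (0, 0) < d \<Longrightarrow> dist (case p of (u, v) \<Rightarrow> b u v) (b 0 0) < 1"
    unfolding continuous_at_eps_delta by (metis (no_types, lifting) case_prod_conv zero_less_one)
  have small: "norm (b u v) \<le> 1" if "norm u \<le> d / 3" "norm v \<le> d / 3" for u v
  proof -
    have "dist (u, v) (0, 0) \<le> norm u + norm v"
      by (simp add: dist_norm norm_Pair_le)
    also have "\<dots> < d" using that d(1) by linarith
    finally show ?thesis using d(2)[of "(u, v)"] by (simp add: zero)
  qed
  have "norm (b u v) \<le> norm u * norm v * (9 / d\<^sup>2)" for u v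
  proof (cases "u = 0 \<or> v = 0")
    case True
    then have "b u v = 0" using scale[of 0 u 1 v] scale[of 1 u 0 v] by auto
    then show ?thesis using d(1) by simp
  next
    case False
    let ?s = "d / (3 * norm u)" and ?t = "d / (3 * norm v)"
    have "norm (b (?s *\<^sub>R u) (?t *\<^sub>R v)) \<le> 1" using False d(1) by (intro small) simp_all
    moreover have "norm (b (?s *\<^sub>R u) (?t *\<^sub>R v)) = ?s * ?t * norm (b u v)"
      using d(1) by (simp only: scale norm_mult norm_of_real) simp
    ultimately have "?s * ?t * norm (b u v) \<le> 1" by simp
    then show ?thesis using False d(1) by (simp add: field_simps power2_eq_square)
  qed
  then show thesis by (rule that)
qed

text \<open>The complex Lax--Milgram lemma; the coercivity may hold after multiplying the form by a number
  \<open>k\<close>. The real lemma solves the real part of the equation, and replacing \<open>v\<close> by \<open>i v\<close> gives the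
  imaginary part.\<close>

lemma lax_milgram:
  fixes c :: "'v::chilbert_space \<Rightarrow> 'v \<Rightarrow> complex"
  assumes c: "sesquilinear c" and cont: "continuous_form c" and e: "e > 0" and k: "k \<noteq> 0"
    and coercive: "\<And>u. Re (k * c u u) \<ge> e * (norm u)\<^sup>2"
    and j: "continuous_clinear j"
  obtains u where "\<And>v. c u v = cinner y (j v)"
proof -
  obtain C where C: "\<And>u v. norm (c u v) \<le> norm u * norm v * C"
    using continuous_sesquilinear_bounded[OF c cont] by blast
  have "bounded_bilinear (\<lambda>u v. Re (k * c u v))"
  proof
    show "\<exists>K. \<forall>u v. norm (Re (k * c u v)) \<le> norm u * norm v * K"
    proof (intro exI allI)
      fix u v
      have "norm (Re (k * c u v)) \<le> norm k * norm (c u v)"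
        using abs_Re_le_cmod[of "k * c u v"] by (simp add: norm_mult)
      also have "\<dots> \<le> norm k * (norm u * norm v * C)" by (intro mult_left_mono C) simp
      finally show "norm (Re (k * c u v)) \<le> norm u * norm v * (norm k * C)" by (simp add: mult_ac)
    qed
  next
    fix t :: real and u u' v v' :: 'v
    show "Re (k * c (u + u') v) = Re (k * c u v) + Re (k * c u' v)"
      and "Re (k * c u (v + v')) = Re (k * c u v) + Re (k * c u v')"
      using c by (simp_all add: sesquilinear_def algebra_simps)
    have "k * c (t *\<^sub>R u) v = of_real t * (k * c u v)" "k * c u (t *\<^sub>R v) = of_real t * (k * c u v)"
      using c by (simp_all add: sesquilinear_scaleR_left sesquilinear_scaleR_right)
    then show "Re (k * c (t *\<^sub>R u) v) = t *\<^sub>R Re (k * c u v)"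
      and "Re (k * c u (t *\<^sub>R v)) = t *\<^sub>R Re (k * c u v)"
      by (simp_all only: real_scaleR_def) simp_all
  qed
  moreover have "bounded_linear (\<lambda>v. Re (k * cinner y (j v)))"
  proof -
    have j': "bounded_linear j" by (rule continuous_clinear_bounded_linear) fact
    have "k * cinner y z = cnj (cinner z (k *\<^sub>C y))" for z
      by (simp add: cinner_scaleC_right cinner_commute[of y])
    then have "Re (k * cinner y z) = inner z (k *\<^sub>C y)" for z
      by (simp add: inner_eq_Re_cinner)
    then show ?thesis
      using bounded_linear_compose[OF bounded_linear_inner_left j'] by simp
  qed
  ultimately obtain u where u: "\<And>v. Re (k * c u v) = Re (k * cinner y (j v))"
    using lax_milgram_real[of "\<lambda>u v. Re (k * c u v)" e] e coercive by blast
  have "c u v = cinner y (j v)" for v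
  proof -
    have "c u (\<i> *\<^sub>C v) = - \<i> * c u v" using c by (simp add: sesquilinear_def)
    moreover have "cinner y (j (\<i> *\<^sub>C v)) = - \<i> * cinner y (j v)"
      using j by (simp add: continuous_clinear_def clinear_def cinner_scaleC_right)
    ultimately have "Im (k * c u v) = Im (k * cinner y (j v))"
      using u[of "\<i> *\<^sub>C v"] by simp
    with u[of v] have "k * c u v = k * cinner y (j v)" by (rule complex_eqI)
    with k show ?thesis by simp
  qed
  then show thesis by (rule that)
qed

text \<open>A weakly convergent sequence indexed by a subsequence of the forms is extended to all indices
  by its weak limit.\<close>

lemma forms_converge_weakly_subseq:
  assumes forms: "forms_converge_weakly b a" and r: "strict_mono (r :: nat \<Rightarrow> nat)"
  shows "forms_converge_weakly (\<lambda>n. b (r n)) a"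
  unfolding forms_converge_weakly_def
proof (intro allI impI)
  fix v u and us :: "nat \<Rightarrow> 'a" assume us: "weakly_converges us u"
  define w where "w m = (if m \<in> range r then us (inv r m) else u)" for m
  have inj: "inj r" using r by (rule strict_mono_imp_inj_on)
  have w_r: "w (r n) = us n" for n by (simp add: w_def inj)
  have "weakly_converges w u"
    unfolding weakly_converges_def
  proof (intro allI impI)
    fix f :: "'a \<Rightarrow> complex" assume "continuous_clinear f"
    then have lim: "(\<lambda>n. f (us n)) \<longlonglongrightarrow> f u" using us by (simp add: weakly_converges_def)
    show "(\<lambda>m. f (w m)) \<longlonglongrightarrow> f u"
    proof (rule metric_LIMSEQ_I)
      fix e :: real assume e: "e > 0"
      then obtain N where N: "\<And>n. n \<ge> N \<Longrightarrow> dist (f (us n)) (f u) < e"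
        using lim metric_LIMSEQ_D by blast
      have "dist (f (w m)) (f u) < e" if "m \<ge> r N" for m
      proof (cases "m \<in> range r")
        case True
        then obtain n where n: "m = r n" by auto
        then have "n \<ge> N" using that r by (simp add: strict_mono_less_eq)
        then show ?thesis using N by (simp add: n w_r)
      qed (simp add: w_def e)
      then show "\<exists>N. \<forall>m\<ge>N. dist (f (w m)) (f u) < e" by blast
    qed
  qed
  then have "(\<lambda>m. b m (w m) v) \<longlonglongrightarrow> a u v" using forms by (simp add: forms_converge_weakly_def)
  then have "(\<lambda>n. b (r n) (w (r n)) v) \<longlonglongrightarrow> a u v"
    by (rule filterlim_compose[OF _ filterlim_subseq[OF r]])
  then show "(\<lambda>n. b (r n) (us n) v) \<longlonglongrightarrow> a u v" by (simp add: w_r)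
qed

lemma forms_converge_weakly_const:
  fixes b :: "'a::complex_inner \<Rightarrow> 'a \<Rightarrow> complex"
  assumes b: "sesquilinear b" and cont: "continuous_form b"
  shows "forms_converge_weakly (\<lambda>n. b) b"
  unfolding forms_converge_weakly_def
proof (intro allI impI)
  fix v u :: 'a and us assume us: "weakly_converges us u"
  have "continuous_on UNIV (\<lambda>u. (u, v))" by (intro continuous_intros)
  then have "continuous_on UNIV (\<lambda>u. b u v)"
    using cont continuous_on_compose2[of UNIV "\<lambda>(u, v). b u v" UNIV "\<lambda>u. (u, v)"]
    by (simp add: continuous_form_def)
  then have "continuous_clinear (\<lambda>u. b u v)"
    using b by (simp add: continuous_clinear_def clinear_def sesquilinear_def scaleC_complex_def)
  then show "(\<lambda>n. b (us n) v) \<longlonglongrightarrow> b u v"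
    using us unfolding weakly_converges_def by blast
qed

lemma symmetric_form_real: "symmetric_form b \<Longrightarrow> Im (b u u) = 0"
  unfolding symmetric_form_def by (metis Reals_cnj_iff complex_is_Real_iff)

text \<open>Ellipticity of the limit form is obtained from the weak convergence by testing with constant
  sequences.\<close>

lemma uniformly_elliptic_limit:
  assumes ell: "uniformly_elliptic b jt" and forms: "forms_converge_weakly b a"
  shows "uniformly_elliptic (\<lambda>n. a) jt"
proof -
  obtain \<mu> \<omega> where "\<mu> > 0" "\<omega> > 0"
    and ge: "\<And>n u. \<mu> * (norm u)\<^sup>2 \<le> Re (b n u u) + \<omega> * (norm (jt u))\<^sup>2"
    using ell unfolding uniformly_elliptic_def by blast
  moreover have "\<mu> * (norm u)\<^sup>2 \<le> Re (a u u) + \<omega> * (norm (jt u))\<^sup>2" for u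
  proof -
    have "(\<lambda>n. b n u u) \<longlonglongrightarrow> a u u"
      using forms weakly_converges_const[of u] unfolding forms_converge_weakly_def by blast
    then have "(\<lambda>n. Re (b n u u) + \<omega> * (norm (jt u))\<^sup>2) \<longlonglongrightarrow> Re (a u u) + \<omega> * (norm (jt u))\<^sup>2"
      by (intro tendsto_add tendsto_Re tendsto_const)
    then show ?thesis by (rule LIMSEQ_le_const) (use ge in auto)
  qed
  ultimately show ?thesis unfolding uniformly_elliptic_def by blast
qed

text \<open>The compactness result behind both the solvability of the resolvent equation and the
  convergence of its solutions. If the solutions \<open>u n\<close> were unbounded, the normalised solutions
  would converge weakly, along a subsequence, to some \<open>w\<close> orthogonal to \<open>S\<close> with
  \<open>cl w v = 0\<close> for all \<open>v\<close>, so that \<open>w = 0\<close>. Their images under the compact map \<open>jt\<close> would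
  then tend to \<open>0\<close> in norm, and by the equation the real parts of the forms on them are bounded above
  by a null sequence; this contradicts ellipticity on unit vectors. Hence the solutions are bounded
  and have a weak limit point, to which the equation passes. The orthogonality to \<open>S\<close> allows for a limit
  form with a kernel.\<close>

lemma solutions_weakly_subconvergent:
  fixes c :: "nat \<Rightarrow> 'v::chilbert_space \<Rightarrow> 'v \<Rightarrow> complex"
    and jt :: "'v \<Rightarrow> 'k::complex_inner" and j :: "'v \<Rightarrow> 'h::complex_inner"
  assumes c: "\<And>n. sesquilinear (c n)" and ell: "uniformly_elliptic c jt"
    and forms: "forms_converge_weakly c cl"
    and jt: "compact_clinear jt" and j: "continuous_clinear j"
    and sol: "\<And>n v. c n (u n) v = cinner (y n) (j v)"
    and ybd: "\<And>n. norm (y n) \<le> Y" and y: "weakly_converges y y0"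
    and ortho: "\<And>n w. w \<in> S \<Longrightarrow> cinner (u n) w = 0"
    and inj: "\<And>z. (\<And>w. w \<in> S \<Longrightarrow> cinner z w = 0) \<Longrightarrow> (\<And>v. cl z v = 0) \<Longrightarrow> z = 0"
  obtains r u0 M where "strict_mono r" and "\<And>n. norm (u n) \<le> M"
    and "weakly_converges (\<lambda>n. u (r n)) u0" and "\<And>v. cl u0 v = cinner y0 (j v)"
proof -
  obtain \<mu> \<omega> where \<mu>: "\<mu> > 0" and \<omega>: "\<omega> > 0"
    and ge: "\<And>n u. \<mu> * (norm u)\<^sup>2 \<le> Re (c n u u) + \<omega> * (norm (jt u))\<^sup>2"
    using ell unfolding uniformly_elliptic_def by blast
  have Y: "Y \<ge> 0" using ybd[of 0] norm_ge_zero order_trans by blast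
  obtain J where J: "\<And>v. norm (j v) \<le> norm v * J" and "J \<ge> 0"
    using bounded_linear.nonneg_bounded[OF continuous_clinear_bounded_linear[OF j]] by auto
  have "\<exists>M. \<forall>n. norm (u n) \<le> M"
  proof (rule ccontr)
    assume "\<not> ?thesis"
    then have unb: "\<And>M. \<exists>n. norm (u n) > M" by (meson not_le)
    \<comment> \<open>Exceeding the norms of all earlier members forces the index beyond \<open>m\<close>.\<close>
    have "\<exists>n>m. norm (u n) > real k" for m k
    proof -
      obtain n where n: "norm (u n) > real k + (\<Sum>i\<le>m. norm (u i))" using unb by blast
      have "norm (u i) \<le> (\<Sum>i\<le>m. norm (u i))" if "i \<le> m" for i
        using that by (intro member_le_sum) auto
      with n have "n > m" by (meson not_le of_nat_0_le_iff add_increasing order_trans)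
      moreover have "norm (u n) > real k" using n sum_nonneg[of "{..m}" "\<lambda>i. norm (u i)"] by simp
      ultimately show ?thesis by blast
    qed
    then have "\<exists>r. \<forall>k. r k < r (Suc k) \<and> norm (u (r (Suc k))) > real k"
      using dependent_nat_choice[of "\<lambda>_ _. True" "\<lambda>k m n. m < n \<and> norm (u n) > real k"] by auto
    then obtain r where r: "\<And>k. r k < r (Suc k)" "\<And>k. norm (u (r (Suc k))) > real k" by blast
    define p where "p k = r (Suc k)" for k
    have p: "strict_mono p" using r(1) by (simp add: p_def strict_mono_Suc_iff)
    define h where "h k = u (p k) /\<^sub>R norm (u (p k))" for k
    have up: "norm (u (p k)) > real k" for k using r(2) by (simp add: p_def)
    then have up0: "norm (u (p k)) > 0" for k using of_nat_0_le_iff order_le_less_trans by blast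
    have h1: "norm (h k) = 1" for k using up0[of k] by (simp add: h_def)
    then obtain q w where q: "strict_mono q" and hw: "weakly_converges (\<lambda>n. h (q n)) w"
      using bounded_weakly_convergent_subsequence[of h 1] by auto
    define t where "t n = p (q n)" for n
    have t: "strict_mono t" using strict_mono_o[OF p q] by (simp add: t_def[abs_def] o_def)
    define d where "d n = inverse (norm (u (t n)))" for n
    have d: "d \<longlonglongrightarrow> 0"
      unfolding d_def
    proof (rule tendsto_inverse_0_at_top, rule filterlim_at_top_mono[OF filterlim_real_sequentially])
      have "real n \<le> norm (u (t n))" for n
        using up[of "q n"] strict_mono_imp_increasing[OF q, of n] unfolding t_def by simp
      then show "\<forall>\<^sub>F n in sequentially. real n \<le> norm (u (t n))" by simp
    qed
    have hq: "h (q n) = d n *\<^sub>R u (t n)" for n by (simp add: h_def d_def t_def)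
    have eq: "c (t n) (h (q n)) v = of_real (d n) * cinner (y (t n)) (j v)" for n v
      by (simp add: hq sesquilinear_scaleR_left[OF c] sol)
    have "w = 0"
    proof (rule inj)
      fix z assume z: "z \<in> S"
      have "cinner (h (q n)) z = 0" for n
        using ortho[OF z] cinner_scaleC_left[of "of_real (d n)" "u (t n)" z]
        by (simp add: hq scaleC_of_real)
      then show "cinner w z = 0"
        using weakly_converges_cinner[OF hw, of z] by (simp add: LIMSEQ_const_iff)
    next
      fix v
      have "(\<lambda>n. c (t n) (h (q n)) v) \<longlonglongrightarrow> cl w v"
        using forms_converge_weakly_subseq[OF forms t] hw unfolding forms_converge_weakly_def by blast
      moreover have "(\<lambda>n. of_real (d n) * cinner (y (t n)) (j v)) \<longlonglongrightarrow> of_real 0 * cinner y0 (j v)"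
        using weakly_converges_cinner[OF weakly_converges_subseq[OF y t]]
        by (intro tendsto_mult tendsto_of_real d)
      ultimately have "cl w v = of_real 0 * cinner y0 (j v)" unfolding eq by (rule LIMSEQ_unique)
      then show "cl w v = 0" by simp
    qed
    have "(\<lambda>n. jt (h (q n))) \<longlonglongrightarrow> jt w"
      by (rule compact_clinear_weakly_to_strongly[OF jt hw, of 1]) (simp add: h1)
    moreover have "jt w = 0"
      using clinear_imp_linear[THEN linear_0, of jt] jt \<open>w = 0\<close> by (simp add: compact_clinear_def)
    ultimately have jt0: "(\<lambda>n. (norm (jt (h (q n))))\<^sup>2) \<longlonglongrightarrow> 0"
      using tendsto_power[OF tendsto_norm_zero, of "\<lambda>n. jt (h (q n))" sequentially 2] by simp
    have "\<mu> \<le> d n * (Y * J) + \<omega> * (norm (jt (h (q n))))\<^sup>2" for n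
    proof -
      have "Re (c (t n) (h (q n)) (h (q n))) = d n * inner (y (t n)) (j (h (q n)))"
        by (simp add: eq inner_eq_Re_cinner)
      also have "inner (y (t n)) (j (h (q n))) \<le> norm (y (t n)) * norm (j (h (q n)))"
        by (rule norm_cauchy_schwarz)
      also have "\<dots> \<le> Y * J"
        using J[of "h (q n)"] by (intro mult_mono ybd) (auto simp: h1 Y)
      finally have "Re (c (t n) (h (q n)) (h (q n))) \<le> d n * (Y * J)"
        by (simp add: d_def mult_left_mono)
      then show ?thesis using ge[of "h (q n)" "t n"] by (simp add: h1)
    qed
    moreover have "(\<lambda>n. d n * (Y * J) + \<omega> * (norm (jt (h (q n))))\<^sup>2) \<longlonglongrightarrow> 0 * (Y * J) + \<omega> * 0"
      by (intro tendsto_add tendsto_mult_right tendsto_mult_left d jt0)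
    ultimately have "\<mu> \<le> 0 * (Y * J) + \<omega> * 0"
      by (intro LIMSEQ_le_const) auto
    with \<mu> show False by simp
  qed
  then obtain M where M: "\<And>n. norm (u n) \<le> M" by blast
  then obtain r u0 where r: "strict_mono r" and u0: "weakly_converges (\<lambda>n. u (r n)) u0"
    using bounded_weakly_convergent_subsequence by blast
  have "cl u0 v = cinner y0 (j v)" for v
  proof (rule LIMSEQ_unique)
    show "(\<lambda>n. c (r n) (u (r n)) v) \<longlonglongrightarrow> cl u0 v"
      using forms_converge_weakly_subseq[OF forms r] u0 unfolding forms_converge_weakly_def by blast
    show "(\<lambda>n. c (r n) (u (r n)) v) \<longlonglongrightarrow> cinner y0 (j v)"
      unfolding sol by (rule weakly_converges_cinner[OF weakly_converges_subseq[OF y r]])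
  qed
  with r M u0 show thesis by (rule that)
qed

section \<open>Resolvents of the associated graphs\<close>

text \<open>The form whose equation \<open>shifted_form b j s u v = cinner y (j v)\<close> for all \<open>v\<close> expresses that
  \<open>(j u, y)\<close> belongs to the graph associated with \<open>b\<close>, shifted by \<open>i s\<close>.\<close>

definition shifted_form ::
    "('v::complex_inner \<Rightarrow> 'v \<Rightarrow> complex) \<Rightarrow> ('v \<Rightarrow> 'h::complex_inner) \<Rightarrow> real \<Rightarrow> 'v \<Rightarrow> 'v \<Rightarrow> complex"
  where "shifted_form b j s u v = b u v + \<i> * of_real s * cinner (j u) (j v)"

abbreviation (input) resolvent ::
    "('v::complex_inner \<Rightarrow> 'v \<Rightarrow> complex) \<Rightarrow> ('v \<Rightarrow> 'h::complex_inner) \<Rightarrow> real \<Rightarrow> 'h \<Rightarrow> 'h"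
  where "resolvent b j s \<equiv> graph_inverse (graph_shift (assoc_graph b j) (\<i> * of_real s))"

lemma graph_shift_assoc_graph_iff:
  "(x, y) \<in> graph_shift (assoc_graph b j) (\<i> * of_real s) \<longleftrightarrow>
    (\<exists>u. j u = x \<and> (\<forall>v. shifted_form b j s u v = cinner y (j v)))" (is "?l \<longleftrightarrow> ?r")
proof
  assume ?l
  then show ?r
    by (auto simp: graph_shift_def assoc_graph_def shifted_form_def cinner_add_left cinner_scaleC_left)
next
  assume ?r
  then obtain u where u: "j u = x" "\<And>v. shifted_form b j s u v = cinner y (j v)" by blast
  let ?y = "y - (\<i> * of_real s) *\<^sub>C x"
  have "b u v = cinner ?y (j v)" for v
    using u(2)[of v] by (simp add: shifted_form_def u(1) cinner_diff_left cinner_scaleC_left algebra_simps)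
  with u(1) have "(x, ?y) \<in> assoc_graph b j" by (auto simp: assoc_graph_def)
  then have "(x, ?y + (\<i> * of_real s) *\<^sub>C x) \<in> graph_shift (assoc_graph b j) (\<i> * of_real s)"
    unfolding graph_shift_def by blast
  then show ?l by simp
qed

lemma sesquilinear_shifted_form:
  assumes "sesquilinear b" "clinear j" shows "sesquilinear (shifted_form b j s)"
  using assms unfolding sesquilinear_def clinear_def shifted_form_def
  by (simp add: cinner_add_left cinner_add_right cinner_scaleC_left cinner_scaleC_right algebra_simps)

lemma continuous_shifted_form:
  assumes "continuous_form b" "continuous_on UNIV j"
  shows "continuous_form (shifted_form b j s)"
proof -
  have "continuous_on UNIV (\<lambda>p. j (fst p))" "continuous_on UNIV (\<lambda>p. j (snd p))"
    using assms(2) by (auto intro!: continuous_on_compose2[of UNIV j] continuous_on_fst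
        continuous_on_snd continuous_on_id)
  then have "continuous_on UNIV (\<lambda>p. \<i> * of_real s * cinner (j (fst p)) (j (snd p)))"
    by (intro continuous_on_mult_left continuous_on_cinner)
  with assms(1) show ?thesis
    unfolding continuous_form_def shifted_form_def case_prod_unfold by (rule continuous_on_add)
qed

lemma Re_shifted_form: "Re (shifted_form b j s u u) = Re (b u u)"
  by (simp add: shifted_form_def cinner_self)

lemma Im_shifted_form: "symmetric_form b \<Longrightarrow> Im (shifted_form b j s u u) = s * (norm (j u))\<^sup>2"
  by (simp add: shifted_form_def cinner_self symmetric_form_real)

lemma forms_converge_weakly_shifted:
  fixes j :: "'v::complex_inner \<Rightarrow> 'h::complex_inner"
  assumes forms: "forms_converge_weakly b a" and j: "continuous_clinear j"
  shows "forms_converge_weakly (\<lambda>n. shifted_form (b n) j s) (shifted_form a j s)"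
  unfolding forms_converge_weakly_def shifted_form_def
proof (intro allI impI)
  fix v u :: 'v and us assume us: "weakly_converges us u"
  have "(\<lambda>n. cinner (j (us n)) (j v)) \<longlonglongrightarrow> cinner (j u) (j v)"
    by (rule weakly_converges_cinner[OF weakly_converges_continuous_clinear[OF us j]])
  moreover have "(\<lambda>n. b n (us n) v) \<longlonglongrightarrow> a u v"
    using forms us unfolding forms_converge_weakly_def by blast
  ultimately show "(\<lambda>n. b n (us n) v + \<i> * of_real s * cinner (j (us n)) (j v))
      \<longlonglongrightarrow> a u v + \<i> * of_real s * cinner (j u) (j v)"
    using tendsto_add tendsto_mult_left by blast
qed

lemma uniformly_elliptic_reindex:
  "uniformly_elliptic b jt \<Longrightarrow> uniformly_elliptic (\<lambda>n. b (f n)) jt"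
  unfolding uniformly_elliptic_def by blast

locale elliptic_form =
  fixes j :: "'v::chilbert_space \<Rightarrow> 'h::chilbert_space"
    and jt :: "'v \<Rightarrow> 'k::chilbert_space"
    and b :: "'v \<Rightarrow> 'v \<Rightarrow> complex"
    and s :: real
  assumes j: "continuous_clinear j" and jt: "compact_clinear jt"
    and sesq: "sesquilinear b" and cont: "continuous_form b" and symm: "symmetric_form b"
    and elliptic: "uniformly_elliptic (\<lambda>n. b) jt" and s: "s \<noteq> 0"
begin

abbreviation solves :: "'v \<Rightarrow> 'h \<Rightarrow> bool" where
  "solves u y \<equiv> \<forall>v. shifted_form b j s u v = cinner y (j v)"

lemma clinear_j: "clinear j"
  using j by (simp add: continuous_clinear_def)

lemma solves_Im: "solves u y \<Longrightarrow> s * (norm (j u))\<^sup>2 = Im (cinner y (j u))"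
  using Im_shifted_form[OF symm, of j s u] by simp

text \<open>On the diagonal \<open>b\<close> is real, so the imaginary part of the equation tested with \<open>u\<close> controls
  \<open>j u\<close> by \<open>y\<close> alone. This is the resolvent bound, and for \<open>y = 0\<close> it identifies the kernel.\<close>

lemma solves_norm_le:
  assumes "solves u y" shows "norm (j u) \<le> norm y * inverse \<bar>s\<bar>"
proof -
  have "\<bar>s\<bar> * (norm (j u))\<^sup>2 = \<bar>s * (norm (j u))\<^sup>2\<bar>" by (simp add: abs_mult)
  also have "\<dots> = \<bar>inner y (\<i> *\<^sub>C j u)\<bar>" by (simp add: solves_Im[OF assms] Im_cinner)
  also have "\<dots> \<le> norm y * norm (j u)"
    using Cauchy_Schwarz_ineq2[of y "\<i> *\<^sub>C j u"] by simp
  finally have "(\<bar>s\<bar> * norm (j u)) * norm (j u) \<le> norm y * norm (j u)"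
    by (simp add: power2_eq_square mult.assoc)
  then have "\<bar>s\<bar> * norm (j u) \<le> norm y"
    by (cases "j u = 0") simp_all
  then show ?thesis using s by (simp add: field_simps)
qed

lemma solves_add: "solves u y \<Longrightarrow> solves u' y' \<Longrightarrow> solves (u + u') (y + y')"
  using sesquilinear_shifted_form[OF sesq clinear_j, of s]
  by (simp add: sesquilinear_def cinner_add_left)

lemma solves_scaleC: "solves u y \<Longrightarrow> solves (c *\<^sub>C u) (c *\<^sub>C y)"
  using sesquilinear_shifted_form[OF sesq clinear_j, of s]
  by (simp add: sesquilinear_def cinner_scaleC_left)

lemma solves_zero_imp_W_form:
  assumes "solves z 0" shows "z \<in> W_form b j"
proof -
  have z: "j z = 0" using solves_norm_le[OF assms] by simp
  with assms have "b z v = 0" for v by (simp add: shifted_form_def)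
  with z show ?thesis by (simp add: W_form_def)
qed

text \<open>The shifted form need not be coercive, and its kernel \<open>W_form b j\<close> may be nonzero. Adding a
  small multiple of the inner product of \<open>V\<close>, times \<open>i\<close>, makes the form coercive after multiplication by
  \<open>- i s\<close>, since \<open>b\<close>, being real on the diagonal, drops out of the imaginary part. Testing with \<open>w\<close> in the
  kernel leaves only the added term, by symmetry, so the solutions of the perturbed equations are orthogonal to
  the kernel. As the perturbation tends to \<open>0\<close>, they have a weak limit point, which solves the
  equation.\<close>

lemma solvable: "\<exists>u. solves u y"
proof -
  \<comment> \<open>The perturbation has the sign of \<open>s\<close>, so that both imaginary terms have the same sign.\<close>
  define e where "e n = s / real (Suc n)" for n
  define c where "c n u v = shifted_form b j s u v + \<i> * of_real (e n) * cinner u v" for n u v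
  have c_sesq: "sesquilinear (c n)" for n
    using sesquilinear_shifted_form[OF sesq clinear_j, of s] unfolding sesquilinear_def c_def
    by (simp add: cinner_add_left cinner_add_right cinner_scaleC_left cinner_scaleC_right
        algebra_simps)
  have c_cont: "continuous_form (c n)" for n
  proof -
    have "continuous_form (shifted_form b j s)"
      using j by (intro continuous_shifted_form cont) (simp add: continuous_clinear_def)
    moreover have "continuous_on UNIV (\<lambda>p :: 'v \<times> 'v. \<i> * of_real (e n) * cinner (fst p) (snd p))"
      by (intro continuous_intros)
    ultimately show ?thesis
      unfolding continuous_form_def c_def case_prod_unfold by (rule continuous_on_add)
  qed
  have "\<exists>u. \<forall>v. c n u v = cinner y (j v)" for n
  proof -
    let ?k = "- \<i> * of_real s"
    have "Re (?k * c n u u) \<ge> s * e n * (norm u)\<^sup>2" for u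
    proof -
      have "Re (?k * c n u u) = s * Im (c n u u)" by simp
      also have "\<dots> = s\<^sup>2 * (norm (j u))\<^sup>2 + s * e n * (norm u)\<^sup>2"
        by (simp add: c_def Im_shifted_form[OF symm] cinner_self power2_eq_square algebra_simps)
      finally show ?thesis by simp
    qed
    moreover have "s * e n = s\<^sup>2 / real (Suc n)" by (simp add: e_def power2_eq_square)
    then have "s * e n > 0" "?k \<noteq> 0" using s by simp_all
    ultimately obtain u where "\<And>v. c n u v = cinner y (j v)"
      using lax_milgram[OF c_sesq c_cont _ _ _ j, of "s * e n" ?k n] by blast
    then show ?thesis by blast
  qed
  then obtain u where u: "\<And>n v. c n (u n) v = cinner y (j v)" by metis
  have ortho: "cinner (u n) w = 0" if w: "w \<in> W_form b j" for n w
  proof -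
    have "b (u n) w = 0"
      using symm w unfolding symmetric_form_def W_form_def
      by (metis (mono_tags, lifting) complex_cnj_zero mem_Collect_eq)
    with w u[of n w] have "e n = 0 \<or> cinner (u n) w = 0"
      by (simp add: c_def shifted_form_def W_form_def)
    then show ?thesis using s by (simp add: e_def)
  qed
  have ell: "uniformly_elliptic c jt"
  proof -
    have "Re (c n u u) = Re (b u u)" for n u
      by (simp add: c_def Re_shifted_form cinner_self)
    with elliptic show ?thesis by (simp add: uniformly_elliptic_def)
  qed
  have forms: "forms_converge_weakly c (shifted_form b j s)"
    unfolding forms_converge_weakly_def
  proof (intro allI impI)
    fix v w :: 'v and ws assume ws: "weakly_converges ws w"
    have "(\<lambda>n. shifted_form b j s (ws n) v) \<longlonglongrightarrow> shifted_form b j s w v"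
      using forms_converge_weakly_shifted[OF forms_converge_weakly_const[OF sesq cont] j] ws
      unfolding forms_converge_weakly_def by blast
    moreover have "e \<longlonglongrightarrow> 0"
      using tendsto_mult_right_zero[OF LIMSEQ_inverse_real_of_nat, of s]
      by (simp add: e_def[abs_def] divide_inverse)
    ultimately have "(\<lambda>n. c n (ws n) v) \<longlonglongrightarrow> shifted_form b j s w v + \<i> * of_real 0 * cinner w v"
      unfolding c_def
      by (intro tendsto_add tendsto_mult tendsto_const tendsto_of_real weakly_converges_cinner ws)
    then show "(\<lambda>n. c n (ws n) v) \<longlonglongrightarrow> shifted_form b j s w v" by simp
  qed
  have inj: "z = 0" if "\<And>w. w \<in> W_form b j \<Longrightarrow> cinner z w = 0"
    and "\<And>v. shifted_form b j s z v = 0" for z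
  proof -
    have "z \<in> W_form b j" using that(2) by (intro solves_zero_imp_W_form) simp
    then have "cinner z z = 0" by (rule that(1))
    then show ?thesis by (simp add: cinner_self)
  qed
  obtain u0 :: 'v where "\<And>v. shifted_form b j s u0 v = cinner y (j v)"
  proof (rule solutions_weakly_subconvergent[OF c_sesq ell forms jt j u order_refl
        weakly_converges_const ortho])
    fix z assume "\<And>w. w \<in> W_form b j \<Longrightarrow> cinner z w = 0" "\<And>v. shifted_form b j s z v = 0"
    then show "z = 0" by (rule inj)
  next
    fix u0 :: 'v assume "\<And>v. shifted_form b j s u0 v = cinner y (j v)"
    then show thesis by (rule that)
  qed
  then show ?thesis by blast
qed

text \<open>The solution \<open>u\<close> is unique only up to the kernel \<open>W\<close>, but \<open>j u\<close>, the value of the resolvent, is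
  determined.\<close>

lemma solves_unique:
  assumes "solves u y" "solves u' y" shows "j u = j u'"
proof -
  have "solves (u + (- 1) *\<^sub>C u') (y + (- 1) *\<^sub>C y)"
    by (rule solves_add[OF assms(1) solves_scaleC[OF assms(2)]])
  then have "solves (u - u') 0" by simp
  from solves_norm_le[OF this] have "j (u - u') = 0" by simp
  then show ?thesis using linear_diff[OF clinear_imp_linear[OF clinear_j]] by simp
qed

lemma resolvent_eq: "solves u y \<Longrightarrow> resolvent b j s y = j u"
  unfolding graph_inverse_def graph_shift_assoc_graph_iff
proof (rule the_equality)
  assume u: "solves u y"
  then show "\<exists>u'. j u' = j u \<and> solves u' y" by blast
  show "x = j u" if "\<exists>u'. j u' = x \<and> solves u' y" for x
    using that solves_unique[OF u] by auto
qed

lemma norm_resolvent_le: "norm (resolvent b j s y) \<le> norm y * inverse \<bar>s\<bar>"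
proof -
  obtain u where u: "solves u y" using solvable by blast
  show ?thesis using solves_norm_le[OF u] unfolding resolvent_eq[OF u] .
qed

lemma clinear_resolvent: "clinear (resolvent b j s)"
  unfolding clinear_def
proof (intro conjI allI)
  fix y y'
  obtain u u' where u: "solves u y" and u': "solves u' y'" using solvable by blast
  show "resolvent b j s (y + y') = resolvent b j s y + resolvent b j s y'"
    using resolvent_eq[OF solves_add[OF u u']] resolvent_eq[OF u] resolvent_eq[OF u'] clinear_j
    by (simp add: clinear_def)
next
  fix c y
  obtain u where u: "solves u y" using solvable by blast
  show "resolvent b j s (c *\<^sub>C y) = c *\<^sub>C resolvent b j s y"
    using resolvent_eq[OF solves_scaleC[OF u]] resolvent_eq[OF u] clinear_j
    by (simp add: clinear_def)
qed

lemma bounded_linear_resolvent: "bounded_linear (resolvent b j s)"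
proof -
  interpret linear "resolvent b j s" by (rule clinear_imp_linear[OF clinear_resolvent])
  show ?thesis using add scale norm_resolvent_le by (rule bounded_linear_intro)
qed

lemma graph_invertible_shift: "graph_invertible (graph_shift (assoc_graph b j) (\<i> * of_real s))"
  unfolding graph_invertible_def
proof (intro conjI allI)
  fix y
  obtain u where u: "solves u y" using solvable by blast
  show "\<exists>!x. (x, y) \<in> graph_shift (assoc_graph b j) (\<i> * of_real s)"
    unfolding graph_shift_assoc_graph_iff
  proof (rule ex1I[of _ "j u"])
    show "\<exists>u'. j u' = j u \<and> solves u' y" using u by blast
    show "x = j u" if "\<exists>u'. j u' = x \<and> solves u' y" for x
      using that solves_unique[OF u] by auto
  qed
next
  show "continuous_clinear (resolvent b j s)"
    by (rule bounded_linear_clinear_continuous[OF clinear_resolvent bounded_linear_resolvent])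
qed

end

section \<open>Convergence of resolvents\<close>

lemma exists_near_maximiser:
  fixes f :: "'a::real_normed_vector \<Rightarrow> 'b::real_normed_vector"
  assumes f: "bounded_linear f" and d: "d > 0"
  obtains y where "norm y \<le> 1" and "onorm f \<le> norm (f y) + d"
proof -
  interpret f: bounded_linear f by fact
  have "\<exists>y. norm y \<le> 1 \<and> onorm f \<le> norm (f y) + d"
  proof (rule ccontr)
    assume "\<not> ?thesis"
    then have less: "norm (f y) < onorm f - d" if "norm y \<le> 1" for y using that by fastforce
    have "onorm f \<le> onorm f - d"
    proof (rule onorm_bound)
      show "0 \<le> onorm f - d" using less[of 0] by simp
      show "norm (f x) \<le> (onorm f - d) * norm x" for x
        using less[of "x /\<^sub>R norm x"] by (cases "x = 0") (simp_all add: f.scaleR field_simps)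
    qed
    with d show False by simp
  qed
  then show thesis using that by blast
qed

text \<open>The solutions \<open>u n\<close> of the resolvent equations converge weakly along subsequences. If \<open>j\<close> is
  compact it turns this into norm convergence of \<open>j (u n)\<close>. If \<open>y\<close> is constant, the norms of
  \<open>j (u n)\<close> converge, since the imaginary part of the equation gives
  \<open>s * (norm (j u))\<^sup>2 = Im (cinner y (j u))\<close>; for weakly convergent sequences in \<open>H\<close> this
  suffices for norm convergence.\<close>

lemma resolvents_tendsto:
  fixes a :: "'v::chilbert_space \<Rightarrow> 'v \<Rightarrow> complex"
    and j :: "'v \<Rightarrow> 'h::chilbert_space" and jt :: "'v \<Rightarrow> 'k::chilbert_space"
  assumes b: "\<And>n. elliptic_form j jt (b n) s" and a: "elliptic_form j jt a s"
    and ell: "uniformly_elliptic b jt" and forms: "forms_converge_weakly b a"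
    and W: "W_form a j = {0}"
    and ybd: "\<And>n. norm (y n) \<le> Y" and y: "weakly_converges y y0"
    and cases: "compact_clinear j \<or> (\<forall>n. y n = y0)"
  shows "(\<lambda>n. resolvent (b n) j s (y n)) \<longlonglongrightarrow> resolvent a j s y0"
proof (rule tendsto_if_all_subseqs)
  interpret a: elliptic_form j jt a s by (rule a)
  fix r :: "nat \<Rightarrow> nat" assume r: "strict_mono r"
  have "\<exists>u. \<forall>v. shifted_form (b (r n)) j s u v = cinner (y (r n)) (j v)" for n
    by (rule elliptic_form.solvable[OF b])
  then obtain u where u: "\<And>n v. shifted_form (b (r n)) j s (u n) v = cinner (y (r n)) (j v)"
    by metis
  have res: "resolvent (b (r n)) j s (y (r n)) = j (u n)" for n
    using elliptic_form.resolvent_eq[OF b] u by blast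
  have sesq: "sesquilinear (shifted_form (b (r n)) j s)" for n
    by (rule sesquilinear_shifted_form[OF elliptic_form.sesq[OF b] a.clinear_j])
  have ell': "uniformly_elliptic (\<lambda>n. shifted_form (b (r n)) j s) jt"
    using uniformly_elliptic_reindex[OF ell] unfolding uniformly_elliptic_def Re_shifted_form .
  have forms': "forms_converge_weakly (\<lambda>n. shifted_form (b (r n)) j s) (shifted_form a j s)"
    by (rule forms_converge_weakly_shifted[OF forms_converge_weakly_subseq[OF forms r] a.j])
  have inj: "z = 0" if "\<And>v. shifted_form a j s z v = 0" for z
    using a.solves_zero_imp_W_form[of z] that W by simp
  obtain q u0 M where q: "strict_mono q" and M: "\<And>n. norm (u n) \<le> M"
    and weak: "weakly_converges (\<lambda>n. u (q n)) u0"
    and u0: "\<And>v. shifted_form a j s u0 v = cinner y0 (j v)"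
  proof (rule solutions_weakly_subconvergent[OF sesq ell' forms' a.jt a.j u ybd
        weakly_converges_subseq[OF y r], where S = "{}"])
    fix z assume "\<And>v. shifted_form a j s z v = 0"
    then show "z = 0" by (rule inj)
  qed auto
  have weak_j: "weakly_converges (\<lambda>n. j (u (q n))) (j u0)"
    by (rule weakly_converges_continuous_clinear[OF weak a.j])
  have "(\<lambda>n. j (u (q n))) \<longlonglongrightarrow> j u0"
    using cases
  proof
    assume "compact_clinear j"
    then show ?thesis using weak M by (rule compact_clinear_weakly_to_strongly)
  next
    assume const: "\<forall>n. y n = y0"
    have "s * (norm (j (u n)))\<^sup>2 = inner y0 (\<i> *\<^sub>C j (u n))" for n
      using elliptic_form.solves_Im[OF b, of "r n" "u n" "y (r n)"] u const by (simp add: Im_cinner)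
    then have norms: "(norm (j (u n)))\<^sup>2 = inverse s * inner y0 (\<i> *\<^sub>C j (u n))" for n
      using a.s by (simp add: field_simps)
    have norm0: "(norm (j u0))\<^sup>2 = inverse s * inner y0 (\<i> *\<^sub>C j u0)"
      using a.solves_Im[of u0 y0] u0 a.s by (simp add: Im_cinner field_simps)
    have "(\<lambda>n. Im (cinner (j (u (q n))) y0)) \<longlonglongrightarrow> Im (cinner (j u0) y0)"
      by (rule tendsto_Im[OF weakly_converges_cinner[OF weak_j]])
    moreover have "inner y0 (\<i> *\<^sub>C x) = - Im (cinner x y0)" for x :: 'h
      by (subst cinner_commute) (simp add: Im_cinner)
    ultimately have "(\<lambda>n. (norm (j (u (q n))))\<^sup>2) \<longlonglongrightarrow> (norm (j u0))\<^sup>2"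
      unfolding norms norm0 by (intro tendsto_mult_left) (simp add: tendsto_minus)
    with weak_j show ?thesis by (rule weakly_converges_norm_imp_tendsto)
  qed
  moreover have "resolvent a j s y0 = j u0" using a.resolvent_eq u0 by blast
  ultimately show "\<exists>q. strict_mono q \<and>
      (\<lambda>n. resolvent (b (r (q n))) j s (y (r (q n)))) \<longlonglongrightarrow> resolvent a j s y0"
    using q by (auto simp: res)
qed

text \<open>For the operator norm, the resolvents are compared on vectors \<open>y n\<close> of norm at most one that
  nearly realise the norm of the difference. Along a subsequence \<open>y\<close> converges weakly,
  and then the resolvents of \<open>b n\<close> and that of \<open>a\<close>, the latter regarded as a constant
  sequence, send \<open>y n\<close> to sequences with the same limit.\<close>

lemma resolvents_onorm_tendsto:
  fixes a :: "'v::chilbert_space \<Rightarrow> 'v \<Rightarrow> complex"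
    and j :: "'v \<Rightarrow> 'h::chilbert_space" and jt :: "'v \<Rightarrow> 'k::chilbert_space"
  assumes b: "\<And>n. elliptic_form j jt (b n) s" and a: "elliptic_form j jt a s"
    and ell: "uniformly_elliptic b jt" and forms: "forms_converge_weakly b a"
    and W: "W_form a j = {0}" and compact: "compact_clinear j"
  shows "(\<lambda>n. onorm (\<lambda>y. resolvent (b n) j s y - resolvent a j s y)) \<longlonglongrightarrow> 0"
proof -
  interpret a: elliptic_form j jt a s by (rule a)
  define D where "D n y = resolvent (b n) j s y - resolvent a j s y" for n y
  have bl: "bounded_linear (D n)" for n
    unfolding D_def by (intro bounded_linear_sub elliptic_form.bounded_linear_resolvent[OF b]
        a.bounded_linear_resolvent)
  have "\<exists>y. norm y \<le> 1 \<and> onorm (D n) \<le> norm (D n y) + inverse (real (Suc n))" for n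
    using exists_near_maximiser[OF bl, of "inverse (real (Suc n))" n] by auto
  then obtain y where y1: "\<And>n. norm (y n) \<le> 1"
    and yD: "\<And>n. onorm (D n) \<le> norm (D n (y n)) + inverse (real (Suc n))" by metis
  have "(\<lambda>n. D n (y n)) \<longlonglongrightarrow> 0"
  proof (rule tendsto_if_all_subseqs)
    fix r :: "nat \<Rightarrow> nat" assume r: "strict_mono r"
    obtain q y0 where q: "strict_mono q" and y0: "weakly_converges (\<lambda>n. y (r (q n))) y0"
      using bounded_weakly_convergent_subsequence[of "\<lambda>n. y (r n)" 1] y1 by auto
    have rq: "strict_mono (\<lambda>n. r (q n))" using strict_mono_o[OF r q] by (simp add: o_def)
    have "(\<lambda>n. resolvent (b (r (q n))) j s (y (r (q n)))) \<longlonglongrightarrow> resolvent a j s y0"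
      by (rule resolvents_tendsto[OF b a uniformly_elliptic_reindex[OF ell] forms_converge_weakly_subseq[OF forms rq] W y1 y0])
        (simp add: compact)
    moreover have "(\<lambda>n. resolvent a j s (y (r (q n)))) \<longlonglongrightarrow> resolvent a j s y0"
      by (rule resolvents_tendsto[OF a a a.elliptic
            forms_converge_weakly_const[OF a.sesq a.cont] W y1 y0]) (simp add: compact)
    ultimately have "(\<lambda>n. D (r (q n)) (y (r (q n)))) \<longlonglongrightarrow> resolvent a j s y0 - resolvent a j s y0"
      unfolding D_def by (rule tendsto_diff)
    with q show "\<exists>q. strict_mono q \<and> (\<lambda>n. D (r (q n)) (y (r (q n)))) \<longlonglongrightarrow> 0" by auto
  qed
  then have "(\<lambda>n. norm (D n (y n)) + inverse (real (Suc n))) \<longlonglongrightarrow> 0 + 0"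
    by (rule tendsto_add[OF tendsto_norm_zero LIMSEQ_inverse_real_of_nat])
  then have "(\<lambda>n. norm (D n (y n)) + inverse (real (Suc n))) \<longlonglongrightarrow> 0" by simp
  then have "(\<lambda>n. onorm (D n)) \<longlonglongrightarrow> 0"
    by (rule Lim_null_comparison[rotated]) (use yD onorm_pos_le[OF bl] in auto)
  then show ?thesis unfolding D_def .
qed

theorem theorem5p3:
  fixes j :: "'v::chilbert_space \<Rightarrow> 'h::chilbert_space"
    and jt :: "'v \<Rightarrow> 'k::chilbert_space"
    and a :: "'v \<Rightarrow> 'v \<Rightarrow> complex"
    and an :: "nat \<Rightarrow> 'v \<Rightarrow> 'v \<Rightarrow> complex"
    and A :: "('h \<times> 'h) set"
    and An :: "nat \<Rightarrow> ('h \<times> 'h) set"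
  defines "A \<equiv> assoc_graph a j"
    and "An \<equiv> \<lambda>n. assoc_graph (an n) j"
  assumes "continuous_clinear j"
    and "compact_clinear jt"
    and "sesquilinear a" and "continuous_form a" and "symmetric_form a"
    and "\<And>n. sesquilinear (an n)" and "\<And>n. continuous_form (an n)"
    and "\<And>n. symmetric_form (an n)"
    and "uniformly_elliptic an jt"
    and "forms_converge_weakly an a"
    and "W_form a j = {0}"
  shows "(\<forall>s::real. s \<noteq> 0 \<longrightarrow>
            (\<forall>n. graph_invertible (graph_shift (An n) (\<i> * of_real s))) \<and>
            graph_invertible (graph_shift A (\<i> * of_real s)) \<and>
            (\<forall>y. (\<lambda>n. graph_inverse (graph_shift (An n) (\<i> * of_real s)) y)
                   \<longlonglongrightarrow> graph_inverse (graph_shift A (\<i> * of_real s)) y)) \<and>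
         (compact_clinear j \<longrightarrow>
            (\<forall>s::real. s \<noteq> 0 \<longrightarrow>
              (\<lambda>n. onorm (\<lambda>y. graph_inverse (graph_shift (An n) (\<i> * of_real s)) y -
                              graph_inverse (graph_shift A (\<i> * of_real s)) y))
                \<longlonglongrightarrow> 0))"
proof -
  note ell = \<open>uniformly_elliptic an jt\<close> and forms = \<open>forms_converge_weakly an a\<close>
    and W = \<open>W_form a j = {0}\<close>
  have a: "elliptic_form j jt a s" if "s \<noteq> 0" for s
    by (rule elliptic_form.intro) (fact assms uniformly_elliptic_limit[OF ell forms] that)+
  have an: "elliptic_form j jt (an n) s" if "s \<noteq> 0" for n s
    by (rule elliptic_form.intro) (fact assms uniformly_elliptic_reindex[OF ell] that)+
  show ?thesis
    unfolding A_def An_def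
  proof (intro conjI allI impI)
    fix s :: real assume s: "s \<noteq> 0"
    show "graph_invertible (graph_shift (assoc_graph (an n) j) (\<i> * of_real s))" for n
      by (rule elliptic_form.graph_invertible_shift[OF an[OF s]])
    show "graph_invertible (graph_shift (assoc_graph a j) (\<i> * of_real s))"
      by (rule elliptic_form.graph_invertible_shift[OF a[OF s]])
    show "(\<lambda>n. resolvent (an n) j s y) \<longlonglongrightarrow> resolvent a j s y" for y
      by (rule resolvents_tendsto[OF an[OF s] a[OF s] ell forms W order_refl
            weakly_converges_const]) simp
    show "(\<lambda>n. onorm (\<lambda>y. resolvent (an n) j s y - resolvent a j s y)) \<longlonglongrightarrow> 0"
      if "compact_clinear j"
      by (rule resolvents_onorm_tendsto[OF an[OF s] a[OF s] ell forms W that])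
  qed
qed

end
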